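(* Let $1<p<5$, $\lambda_1<0$, $\lambda_2<0$ and $Z>0$. Then the positive even rational profile $$\phi_0(x)=\left[\frac{-2p(p+1)\lambda_1}{p(p-1)^2\lambda_1^2\left(|x|+R_2^{-1}\left(\frac{Z}{4}\right)\right)^2+(p+1)^2\lambda_2}\right]^{\frac{1}{p-1}},$$ with $R_2$ defined in the context, is an equilibrium (time-independent) solution of $$iu_t+u_{xx}+Z\delta(x)u+\lambda_1u|u|^{p-1}+\lambda_2u|u|^{2p-2}=0,\qquad t,x\in\mathbb{R}.$$
   Context: $\delta$ is the Dirac distribution at the origin. The operator $-\partial_{xx}-Z\delta(x)$ is the self-adjoint operator $A_Z$ on $L^2(\mathbb{R})$ with $A_Zf=-f''$ for $x\ne0$ and domain $D(A_Z)=\{f\in H^1(\mathbb{R})\cap H^2(\mathbb{R}\setminus\{0\}): f'(0+)-f'(0-)=-Zf(0)\}$. That $\phi_0$ is an equilibrium solution means that $\phi_0\in D(A_Z)$ and $A_Z\phi_0-\lambda_1\phi_0|\phi_0|^{p-1}-\lambda_2\phi_0|\phi_0|^{2p-2}=0$, i.e. $\phi_0''+\lambda_1\phi_0|\phi_0|^{p-1}+\lambda_2\phi_0|\phi_0|^{2p-2}=0$ for $x\neq0$ and $\phi_0'(0+)-\phi_0'(0-)=-Z\phi_0(0)$. Here $l_0=\frac{\sqrt{|\lambda_2|}(p+1)}{\sqrt{p}(p-1)\lambda_1}<0$ and $R_2:(-l_0,\infty)\to(0,\infty)$ is the (decreasing) diffeomorphism $R_2(d)=\frac{d}{(p-1)(d^2-l_0^2)}$.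 *)

theory Defs
  imports "HOL-Analysis.Analysis"
begin

section \<open>Sobolev spaces on open subsets of the line\<close>

text \<open>
  Elements of \<open>L\<^sup>2\<close> are represented by functions \<open>real \<Rightarrow> complex\<close>; every notion up to and
  including \<open>equilibrium\<close> depends only on the almost-everywhere class of the functions involved.
  Test functions may be taken real-valued, by linearity.
\<close>

definition test_function :: "real set \<Rightarrow> (real \<Rightarrow> real) \<Rightarrow> bool" where
  "test_function \<Omega> \<psi> \<longleftrightarrow>
     (\<forall>n x. (deriv ^^ n) \<psi> differentiable (at x)) \<and>
     (\<exists>K. compact K \<and> K \<subseteq> \<Omega> \<and> (\<forall>x. x \<notin> K \<longrightarrow> \<psi> x = 0))"

definition locally_integrable :: "real set \<Rightarrow> (real \<Rightarrow> complex) \<Rightarrow> bool" where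
  "locally_integrable \<Omega> f \<longleftrightarrow> (\<forall>K. compact K \<and> K \<subseteq> \<Omega> \<longrightarrow> f absolutely_integrable_on K)"

definition has_weak_deriv :: "real set \<Rightarrow> (real \<Rightarrow> complex) \<Rightarrow> (real \<Rightarrow> complex) \<Rightarrow> bool" where
  "has_weak_deriv \<Omega> f g \<longleftrightarrow>
     locally_integrable \<Omega> f \<and> locally_integrable \<Omega> g \<and>
     (\<forall>\<psi>. test_function \<Omega> \<psi> \<longrightarrow>
        (\<integral>x. deriv \<psi> x *\<^sub>R f x \<partial>lebesgue_on \<Omega>) = - (\<integral>x. \<psi> x *\<^sub>R g x \<partial>lebesgue_on \<Omega>))"

definition L2 :: "real set \<Rightarrow> (real \<Rightarrow> complex) set" where
  "L2 \<Omega> = {f. f \<in> borel_measurable (lebesgue_on \<Omega>) \<and>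
              integrable (lebesgue_on \<Omega>) (\<lambda>x. (cmod (f x))\<^sup>2)}"

definition H1 :: "real set \<Rightarrow> (real \<Rightarrow> complex) set" where
  "H1 \<Omega> = {f \<in> L2 \<Omega>. \<exists>g \<in> L2 \<Omega>. has_weak_deriv \<Omega> f g}"

definition H2 :: "real set \<Rightarrow> (real \<Rightarrow> complex) set" where
  "H2 \<Omega> = {f \<in> L2 \<Omega>. \<exists>g \<in> H1 \<Omega>. has_weak_deriv \<Omega> f g}"


section \<open>The operator \<open>A\<^sub>Z = -\<partial>\<^sub>x\<^sub>x - Z \<delta>\<close>\<close>

text \<open>
  For \<open>f\<close> in \<open>H1 UNIV \<inter> H2 (- {0})\<close> there are a unique continuous representative \<open>h\<close> of \<open>f\<close>,
  a unique representative \<open>g\<close> of the weak derivative of \<open>f\<close> that is continuous off the origin,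
  and one-sided limits \<open>dr\<close>, \<open>dl\<close> of \<open>g\<close> at the origin (one-dimensional Sobolev embedding).
  These give the meaning of \<open>f(0)\<close>, \<open>f'(0+)\<close> and \<open>f'(0-)\<close> below; the existential quantifiers
  only name them.
\<close>

definition delta_jump_condition :: "real \<Rightarrow> (real \<Rightarrow> complex) \<Rightarrow> bool" where
  "delta_jump_condition Z f \<longleftrightarrow>
     (\<exists>h g dr dl.
        continuous_on UNIV h \<and> (AE x in lebesgue. f x = h x) \<and>
        continuous_on (- {0}) g \<and> has_weak_deriv (- {0}) f g \<and>
        (g \<longlongrightarrow> dr) (at_right 0) \<and> (g \<longlongrightarrow> dl) (at_left 0) \<and>
        dr - dl = - complex_of_real Z * h 0)"

definition delta_domain :: "real \<Rightarrow> (real \<Rightarrow> complex) set" where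
  "delta_domain Z = {f \<in> H1 UNIV \<inter> H2 (- {0}). delta_jump_condition Z f}"

text \<open>
  The graph of \<open>A\<^sub>Z\<close>: \<open>delta_op Z f w\<close> says that \<open>f \<in> D(A\<^sub>Z)\<close> and \<open>A\<^sub>Z f = w\<close> in \<open>L\<^sup>2\<close>.
  A relation is used because \<open>w\<close>, as a function, is determined only almost everywhere.
\<close>

definition delta_op :: "real \<Rightarrow> (real \<Rightarrow> complex) \<Rightarrow> (real \<Rightarrow> complex) \<Rightarrow> bool" where
  "delta_op Z f w \<longleftrightarrow>
     f \<in> delta_domain Z \<and> w \<in> L2 UNIV \<and>
     (\<exists>g. has_weak_deriv (- {0}) f g \<and> has_weak_deriv (- {0}) g (\<lambda>x. - w x))"


section \<open>Equilibria of the double-power equation\<close>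

definition nonlinearity :: "real \<Rightarrow> real \<Rightarrow> real \<Rightarrow> complex \<Rightarrow> complex" where
  "nonlinearity p lam1 lam2 z =
     of_real lam1 * z * of_real (cmod z powr (p - 1)) +
     of_real lam2 * z * of_real (cmod z powr (2 * p - 2))"

definition equilibrium ::
    "real \<Rightarrow> real \<Rightarrow> real \<Rightarrow> real \<Rightarrow> (real \<Rightarrow> complex) \<Rightarrow> bool" where
  "equilibrium p lam1 lam2 Z \<phi> \<longleftrightarrow>
     \<phi> \<in> delta_domain Z \<and>
     (\<exists>w. delta_op Z \<phi> w \<and> (AE x in lebesgue. w x - nonlinearity p lam1 lam2 (\<phi> x) = 0))"

text \<open>The same equation in classical form, for the given representative \<open>\<phi>\<close>.\<close>

definition classical_equilibrium ::
    "real \<Rightarrow> real \<Rightarrow> real \<Rightarrow> real \<Rightarrow> (real \<Rightarrow> complex) \<Rightarrow> bool" where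
  "classical_equilibrium p lam1 lam2 Z \<phi> \<longleftrightarrow>
     continuous_on UNIV \<phi> \<and>
     (\<exists>\<phi>' \<phi>'' dr dl.
        (\<forall>x. x \<noteq> 0 \<longrightarrow>
           (\<phi> has_vector_derivative \<phi>' x) (at x) \<and>
           (\<phi>' has_vector_derivative \<phi>'' x) (at x) \<and>
           \<phi>'' x + nonlinearity p lam1 lam2 (\<phi> x) = 0) \<and>
        (\<phi>' \<longlongrightarrow> dr) (at_right 0) \<and> (\<phi>' \<longlongrightarrow> dl) (at_left 0) \<and>
        dr - dl = - complex_of_real Z * \<phi> 0)"


section \<open>The rational profile\<close>

definition l0 :: "real \<Rightarrow> real \<Rightarrow> real \<Rightarrow> real" where
  "l0 p lam1 lam2 = sqrt \<bar>lam2\<bar> * (p + 1) / (sqrt p * (p - 1) * lam1)"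

definition R2 :: "real \<Rightarrow> real \<Rightarrow> real \<Rightarrow> real \<Rightarrow> real" where
  "R2 p lam1 lam2 d = d / ((p - 1) * (d\<^sup>2 - (l0 p lam1 lam2)\<^sup>2))"

definition R2_inv :: "real \<Rightarrow> real \<Rightarrow> real \<Rightarrow> real \<Rightarrow> real" where
  "R2_inv p lam1 lam2 = the_inv_into {- l0 p lam1 lam2 <..} (R2 p lam1 lam2)"

definition profile_base :: "real \<Rightarrow> real \<Rightarrow> real \<Rightarrow> real \<Rightarrow> real \<Rightarrow> real" where
  "profile_base p lam1 lam2 Z x =
     (- 2 * p * (p + 1) * lam1) /
     (p * (p - 1)\<^sup>2 * lam1\<^sup>2 * (\<bar>x\<bar> + R2_inv p lam1 lam2 (Z / 4))\<^sup>2 + (p + 1)\<^sup>2 * lam2)"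

definition profile :: "real \<Rightarrow> real \<Rightarrow> real \<Rightarrow> real \<Rightarrow> real \<Rightarrow> real" where
  "profile p lam1 lam2 Z x = profile_base p lam1 lam2 Z x powr (1 / (p - 1))"

text \<open>The inverse of \<open>R2\<close> and the real power in \<open>profile\<close> are well defined.\<close>

lemma l0_neg:
  assumes "1 < p" "lam1 < 0" "lam2 < 0"
  shows "l0 p lam1 lam2 < 0"
  using assms unfolding l0_def by (intro divide_pos_neg mult_pos_pos mult_pos_neg) auto

lemma R2_strictly_decreasing:
  assumes "1 < p" "lam1 < 0" "lam2 < 0" and "- l0 p lam1 lam2 < d" "d < e"
  shows "R2 p lam1 lam2 e < R2 p lam1 lam2 d"
proof -
  define m where "m = - l0 p lam1 lam2"
  have m: "0 < m" "m < d" using l0_neg[OF assms(1-3)] assms(4) by (auto simp: m_def)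
  have sq: "m\<^sup>2 < d\<^sup>2" "m\<^sup>2 < e\<^sup>2" using m assms(5) by (auto intro!: power_strict_mono)
  have "0 < (e - d) * (d * e + m\<^sup>2)"
    using m assms(5) by (intro mult_pos_pos add_pos_pos) auto
  then have "e * (d\<^sup>2 - m\<^sup>2) < d * (e\<^sup>2 - m\<^sup>2)" by (simp add: algebra_simps power2_eq_square)
  then have "e / (e\<^sup>2 - m\<^sup>2) < d / (d\<^sup>2 - m\<^sup>2)"
    using sq by (simp add: pos_divide_less_eq less_divide_eq)
  then have "e / (e\<^sup>2 - m\<^sup>2) / (p - 1) < d / (d\<^sup>2 - m\<^sup>2) / (p - 1)"
    using assms(1) by (intro divide_strict_right_mono) auto
  then show ?thesis by (simp add: R2_def m_def mult.commute)
qed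

lemma R2_bij_betw:
  assumes "1 < p" "lam1 < 0" "lam2 < 0"
  shows "bij_betw (R2 p lam1 lam2) {- l0 p lam1 lam2 <..} {0<..}"
proof -
  define m where "m = - l0 p lam1 lam2"
  have m: "0 < m" using l0_neg[OF assms] by (simp add: m_def)
  have R: "R2 p lam1 lam2 d = d / ((p - 1) * (d\<^sup>2 - m\<^sup>2))" for d by (simp add: R2_def m_def)
  have inj: "inj_on (R2 p lam1 lam2) {m<..}"
    by (rule linorder_inj_onI)
       (use R2_strictly_decreasing[OF assms] in \<open>force simp: m_def\<close>)+
  have "R2 p lam1 lam2 d > 0" if "m < d" for d
  proof -
    have "m\<^sup>2 < d\<^sup>2" using m that by (auto intro!: power_strict_mono)
    then show ?thesis using m that assms(1) by (auto simp: R)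
  qed
  moreover have "\<exists>d>m. R2 p lam1 lam2 d = y" if "0 < y" for y
  proof -
    define k where "k = y * (p - 1)"
    define s where "s = sqrt (1 + 4 * k\<^sup>2 * m\<^sup>2)"
    define d where "d = (1 + s) / (2 * k)"
    have k: "0 < k" using that assms(1) by (simp add: k_def)
    have s2: "s\<^sup>2 = 1 + 4 * k\<^sup>2 * m\<^sup>2" by (simp add: s_def)
    have s: "0 < s" by (simp add: s_def add_pos_nonneg)
    have "(2 * k * m)\<^sup>2 < s\<^sup>2" by (simp add: s2 power_mult_distrib)
    then have "2 * k * m < s" using s by (meson less_imp_le power2_less_imp_less)
    then have md: "m < d" using k by (simp add: d_def field_simps)
    have kd: "2 * k * d - 1 = s" using k by (simp add: d_def)
    have "(2 * k * d - 1)\<^sup>2 = 1 + 4 * k\<^sup>2 * m\<^sup>2" by (simp only: kd s2)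
    then have "(4 * k) * (k * (d\<^sup>2 - m\<^sup>2)) = (4 * k) * d"
      by (simp add: algebra_simps power2_eq_square)
    then have eq: "k * (d\<^sup>2 - m\<^sup>2) = d" using k by simp
    have "m\<^sup>2 < d\<^sup>2" using m md by (auto intro!: power_strict_mono)
    then have "R2 p lam1 lam2 d = y"
      using eq[symmetric] assms(1) that unfolding R k_def
      by (subst divide_eq_eq) (simp add: mult.assoc)
    then show ?thesis using md by blast
  qed
  ultimately have "R2 p lam1 lam2 ` {m<..} = {0<..}" by (auto simp: image_iff)
  then show ?thesis using inj by (simp add: bij_betw_def m_def)
qed

lemma profile_base_pos:
  assumes "1 < p" "lam1 < 0" "lam2 < 0" "0 < Z"
  shows "0 < profile_base p lam1 lam2 Z x"
proof -
  define d where "d = R2_inv p lam1 lam2 (Z / 4)"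
  note bij = R2_bij_betw[OF assms(1-3)]
  have "d \<in> {- l0 p lam1 lam2 <..}"
    unfolding d_def R2_inv_def using bij assms(4)
    by (intro the_inv_into_into) (auto simp: bij_betw_def)
  then have "(- l0 p lam1 lam2)\<^sup>2 < (\<bar>x\<bar> + d)\<^sup>2"
    using l0_neg[OF assms(1-3)] by (intro power_strict_mono) auto
  moreover have "p * (p - 1)\<^sup>2 * lam1\<^sup>2 > 0" using assms by simp
  ultimately have "p * (p - 1)\<^sup>2 * lam1\<^sup>2 * (l0 p lam1 lam2)\<^sup>2 < p * (p - 1)\<^sup>2 * lam1\<^sup>2 * (\<bar>x\<bar> + d)\<^sup>2"
    by (intro mult_strict_left_mono) auto
  moreover have "p * (p - 1)\<^sup>2 * lam1\<^sup>2 * (l0 p lam1 lam2)\<^sup>2 = - (p + 1)\<^sup>2 * lam2"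
    using assms by (simp add: l0_def power_mult_distrib power_divide)
  moreover have "- 2 * p * (p + 1) * lam1 > 0"
    using assms by (intro mult_neg_neg) (auto simp: mult_less_0_iff)
  ultimately show ?thesis unfolding profile_base_def d_def[symmetric]
    by (intro divide_pos_pos) auto
qed

end

theory Submission
  imports Defs
begin

text \<open>
  Put \<open>y = \<bar>x\<bar> + d\<close> with \<open>R\<^sub>2 d = Z / 4\<close>. Then the profile \<open>u\<close> is \<open>B\<^bsup>1/(p-1)\<^esup>\<close> with
  \<open>B = k / (y\<^sup>2 - l\<^sub>0\<^sup>2)\<close>, so off the origin \<open>u' = -2 sgn(x) R\<^sub>2(y) u\<close>, and differentiating once more
  gives \<open>u'' = -(\<lambda>\<^sub>1 B + \<lambda>\<^sub>2 B\<^sup>2) u\<close>, which is the equation because \<open>u\<^bsup>p-1\<^esup> = B\<close>. The slope jumps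
  by \<open>-4 R\<^sub>2(d) u(0) = -Z u(0)\<close> at the origin. Since \<open>\<bar>u'\<bar>\<close> and \<open>\<bar>u''\<bar>\<close> are bounded by multiples of
  \<open>u\<close>, all memberships in \<open>L\<^sup>2\<close> reduce to that of \<open>u\<close>, where \<open>u\<^sup>2 = O(\<bar>x\<bar>\<^bsup>-4/(p-1)\<^esup>)\<close> is integrable
  because \<open>p < 5\<close>; the classical derivatives are weak ones by integration by parts.
\<close>

section \<open>Weak derivatives and square integrability\<close>

lemma L2_UNIV_subset:
  assumes "f \<in> L2 UNIV" "\<Omega> \<in> sets lebesgue"
  shows "f \<in> L2 \<Omega>"
proof -
  have f: "f \<in> borel_measurable lebesgue" "integrable lebesgue (\<lambda>x. (cmod (f x))\<^sup>2)"
    using assms(1) by (auto simp: L2_def lebesgue_on_UNIV_eq)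
  have "f \<in> borel_measurable (lebesgue_on \<Omega>)"
    using f(1) by (rule measurable_restrict_space1)
  moreover have "integrable (lebesgue_on \<Omega>) (\<lambda>x. (cmod (f x))\<^sup>2)"
    using assms(2) integrable_mult_indicator[OF assms(2) f(2)]
    by (simp add: integrable_restrict_space)
  ultimately show ?thesis by (simp add: L2_def)
qed

lemma L2_dominated:
  assumes "f \<in> L2 \<Omega>" "g \<in> borel_measurable (lebesgue_on \<Omega>)" "\<And>x. cmod (g x) \<le> c * cmod (f x)"
  shows "g \<in> L2 \<Omega>"
proof -
  have "integrable (lebesgue_on \<Omega>) (\<lambda>x. c\<^sup>2 * (cmod (f x))\<^sup>2)"
    using assms(1) by (auto simp: L2_def)
  then have "integrable (lebesgue_on \<Omega>) (\<lambda>x. (cmod (g x))\<^sup>2)"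
  proof (rule Bochner_Integration.integrable_bound)
    show "(\<lambda>x. (cmod (g x))\<^sup>2) \<in> borel_measurable (lebesgue_on \<Omega>)"
      using assms(2) by measurable
    have "(cmod (g x))\<^sup>2 \<le> (c * cmod (f x))\<^sup>2" for x
      using assms(3) by (rule power_mono) simp
    then show "AE x in lebesgue_on \<Omega>. norm ((cmod (g x))\<^sup>2) \<le> norm (c\<^sup>2 * (cmod (f x))\<^sup>2)"
      by (simp add: power_mult_distrib)
  qed
  then show ?thesis using assms(2) by (simp add: L2_def)
qed

text \<open>On a compact set constants are integrable, and \<open>t \<le> 1 + t\<^sup>2\<close>, so
  the square of the modulus dominates the modulus up to a constant.\<close>

lemma L2_imp_locally_integrable:
  assumes "f \<in> L2 \<Omega>" "\<Omega> \<in> sets lebesgue"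
  shows "locally_integrable \<Omega> f"
  unfolding locally_integrable_def
proof (intro allI impI)
  fix K assume K: "compact K \<and> K \<subseteq> \<Omega>"
  have [measurable]: "K \<in> sets lebesgue" using K by (simp add: lmeasurable_compact fmeasurableD)
  have meas: "f \<in> borel_measurable (lebesgue_on K)"
    by (rule measurable_restrict_mono[of f lebesgue \<Omega>]) (use assms(1) K in \<open>simp_all add: L2_def\<close>)
  have "integrable lebesgue (\<lambda>x. indicator \<Omega> x *\<^sub>R (cmod (f x))\<^sup>2)"
    using assms by (simp add: L2_def integrable_restrict_space)
  then have "integrable lebesgue (\<lambda>x. indicator K x *\<^sub>R (indicator \<Omega> x *\<^sub>R (cmod (f x))\<^sup>2))"
    by (rule integrable_mult_indicator[rotated]) simp
  also have "(\<lambda>x. indicator K x *\<^sub>R (indicator \<Omega> x *\<^sub>R (cmod (f x))\<^sup>2)) =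
      (\<lambda>x. indicator K x *\<^sub>R (cmod (f x))\<^sup>2)"
    using K by (auto simp: fun_eq_iff split: split_indicator)
  finally have "(\<lambda>x. (cmod (f x))\<^sup>2) absolutely_integrable_on K"
    by (simp add: set_integrable_def)
  moreover have "(\<lambda>x. 1::real) absolutely_integrable_on K"
    using K by (simp add: absolutely_integrable_on_iff_nonneg integrable_on_const lmeasurable_compact)
  ultimately have "(\<lambda>x. 1 + (cmod (f x))\<^sup>2) absolutely_integrable_on K"
    by (intro set_integral_add)
  then have int: "(\<lambda>x. 1 + (cmod (f x))\<^sup>2) integrable_on K"
    by (rule set_lebesgue_integral_eq_integral)
  have "cmod (f x) \<le> 1 + (cmod (f x))\<^sup>2" for x
    using zero_le_power2[of "cmod (f x) - 1/2"] by (simp add: power2_eq_square algebra_simps)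
  then show "f absolutely_integrable_on K"
    by (intro measurable_bounded_by_integrable_imp_absolutely_integrable[OF meas _ int]) auto
qed

text \<open>Integration by parts: the product of a test function with \<open>f\<close> is continuous
  on the whole line and vanishes outside a compact set, so its derivative integrates to zero.
  Continuity of the product lets the fundamental theorem of calculus skip the finite set
  \<open>S\<close>, which will hold the corner of the profile.\<close>

lemma has_weak_derivI:
  assumes "open \<Omega>" "continuous_on \<Omega> f" "finite S"
    and deriv: "\<And>x. x \<in> \<Omega> - S \<Longrightarrow> (f has_vector_derivative g x) (at x)"
    and f: "locally_integrable \<Omega> f" and g: "locally_integrable \<Omega> g"
  shows "has_weak_deriv \<Omega> f g"
  unfolding has_weak_deriv_def
proof (intro conjI f g allI impI)
  fix \<psi> assume "test_function \<Omega> \<psi>"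
  then obtain K where diff: "\<And>n x. (deriv ^^ n) \<psi> differentiable (at x)"
    and K: "compact K" "K \<subseteq> \<Omega>" "\<And>x. x \<notin> K \<Longrightarrow> \<psi> x = 0"
    unfolding test_function_def by blast
  have der: "(\<psi> has_vector_derivative deriv \<psi> x) (at x)" for x
    using diff[of 0 x] by (simp add: real_differentiable_def DERIV_deriv_iff_has_field_derivative
      has_real_derivative_iff_has_vector_derivative[symmetric] DERIV_deriv_iff_real_differentiable)
  have cont: "continuous_on A \<psi>" "continuous_on A (deriv \<psi>)" for A
    using diff[of 0] diff[of 1]
    by (auto intro!: continuous_at_imp_continuous_on differentiable_imp_continuous_within)
  have zero: "deriv \<psi> x = 0" if "x \<notin> K" for x
  proof -
    have "eventually (\<lambda>y. y \<in> - K) (nhds x)"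
      using K(1) that by (intro eventually_nhds_in_open) (auto simp: compact_imp_closed open_Compl)
    then have "eventually (\<lambda>y. \<psi> y = 0) (nhds x)"
      by eventually_elim (use K(3) in auto)
    then have "deriv \<psi> x = deriv (\<lambda>_. 0) x"
      by (rule deriv_cong_ev) simp
    then show ?thesis by simp
  qed
  have K_meas: "K \<in> sets lebesgue" using K(1) by (simp add: lmeasurable_compact fmeasurableD)
  have int: "(\<lambda>x. \<eta> x *\<^sub>R h x) absolutely_integrable_on K"
    if "continuous_on UNIV \<eta>" "locally_integrable \<Omega> h" for \<eta> :: "real \<Rightarrow> real" and h
  proof (rule absolutely_integrable_bounded_measurable_product[where h = "(*\<^sub>R)", OF _ _ K_meas])
    have chi: "continuous_on K \<eta>" using that(1) continuous_on_subset by blast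
    show "\<eta> \<in> borel_measurable (lebesgue_on K)"
      using chi K_meas by (rule continuous_imp_measurable_on_sets_lebesgue)
    show "bounded (\<eta> ` K)"
      using chi K(1) by (intro compact_imp_bounded compact_continuous_image)
    show "h absolutely_integrable_on K"
      using that(2) K by (auto simp: locally_integrable_def)
    show "bilinear ((*\<^sub>R) :: real \<Rightarrow> complex \<Rightarrow> complex)"
      by (simp add: bilinear_conv_bounded_bilinear bounded_bilinear_scaleR)
  qed
  \<comment> \<open>Both integrands vanish off \<open>K\<close>, so the integrals over
    \<open>\<Omega>\<close> can be moved to \<open>K\<close>, where local integrability
    applies.\<close>
  have restrict: "(\<integral>x. u x \<partial>lebesgue_on \<Omega>) = (LINT x:K|lebesgue. u x)"
    if "\<And>x. x \<notin> K \<Longrightarrow> u x = 0" for u :: "real \<Rightarrow> complex"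
  proof -
    have "(\<lambda>x. indicator \<Omega> x *\<^sub>R u x) = (\<lambda>x. indicator K x *\<^sub>R u x)"
      using that K(2) by (auto simp: fun_eq_iff split: split_indicator)
    then show ?thesis
      using assms(1) by (simp add: integral_restrict_space set_lebesgue_integral_def)
  qed
  define u where "u x = deriv \<psi> x *\<^sub>R f x + \<psi> x *\<^sub>R g x" for x
  have u_zero: "u x = 0" if "x \<notin> K" for x using that zero K(3) by (simp add: u_def)
  obtain a b where ab: "K \<subseteq> {a<..<b}" "a \<le> b"
  proof -
    obtain e where "e > 0" "\<And>x. x \<in> K \<Longrightarrow> norm x < e"
      using compact_imp_bounded[OF K(1)] by (auto simp: bounded_pos_less)
    then have "K \<subseteq> {- e<..<e}" by (auto simp: abs_less_iff minus_less_iff)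
    then show ?thesis using \<open>e > 0\<close> by (intro that) auto
  qed
  \<comment> \<open>Nothing is known about \<open>f\<close> outside \<open>\<Omega>\<close>, but
    there the product is zero on the open complement of \<open>K\<close>.\<close>
  have prod_off: "((\<lambda>x. \<psi> x *\<^sub>R f x) has_vector_derivative 0) (at x)" if "x \<notin> K" for x
  proof (rule has_vector_derivative_transform_within_open)
    show "((\<lambda>x. 0) has_vector_derivative (0::complex)) (at x)" by simp
    show "open (- K)" using K(1) by (simp add: compact_imp_closed open_Compl)
  qed (use that K(3) in auto)
  have prod_on: "((\<lambda>x. \<psi> x *\<^sub>R f x) has_vector_derivative u x) (at x)" if "x \<in> \<Omega> - S" for x
    using has_vector_derivative_scaleR[OF der[of x, folded has_real_derivative_iff_has_vector_derivative] deriv[OF that]]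
    by (simp add: u_def add.commute)
  have prod_deriv: "((\<lambda>x. \<psi> x *\<^sub>R f x) has_vector_derivative u x) (at x)" if "x \<notin> S" for x
    using that prod_on[of x] prod_off[of x] K(2) u_zero[of x] by (cases "x \<in> K") auto
  have prod_cont: "isCont (\<lambda>x. \<psi> x *\<^sub>R f x) x" for x
  proof (cases "x \<in> \<Omega>")
    case True
    have "isCont f x" using True assms(1,2) by (simp add: continuous_on_eq_continuous_at)
    moreover have "isCont \<psi> x" using cont(1)[of UNIV] by (simp add: continuous_on_eq_continuous_at)
    ultimately show ?thesis by (intro continuous_intros)
  next
    case False
    then show ?thesis using prod_off[of x] K(2) has_vector_derivative_continuous by blast
  qed
  have "(u has_integral (\<psi> b *\<^sub>R f b - \<psi> a *\<^sub>R f a)) {a..b}"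
    using prod_deriv prod_cont ab(2) assms(3)
    by (intro fundamental_theorem_of_calculus_interior_strong[of S])
       (auto intro: continuous_at_imp_continuous_on)
  moreover have "\<psi> a = 0" "\<psi> b = 0" using ab K(3) by force+
  ultimately have "(u has_integral 0) {a..b}" by simp
  moreover have "u = (\<lambda>x. if x \<in> K then u x else 0)" using u_zero by auto
  ultimately have "(u has_integral 0) K"
    using ab(1) has_integral_restrict[of K "{a..b}" u 0] by force
  have int1: "(\<lambda>x. deriv \<psi> x *\<^sub>R f x) absolutely_integrable_on K"
    and int2: "(\<lambda>x. \<psi> x *\<^sub>R g x) absolutely_integrable_on K"
    using int cont f g by blast+
  have "u absolutely_integrable_on K"
    unfolding u_def using int1 int2 by (rule set_integral_add)
  then have "(LINT x:K|lebesgue. u x) = 0"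
    using \<open>(u has_integral 0) K\<close> by (simp add: set_lebesgue_integral_eq_integral integral_unique)
  then have "(LINT x:K|lebesgue. deriv \<psi> x *\<^sub>R f x) = - (LINT x:K|lebesgue. \<psi> x *\<^sub>R g x)"
    using int1 int2 unfolding u_def by (simp add: set_integral_add eq_neg_iff_add_eq_0)
  then show "(\<integral>x. deriv \<psi> x *\<^sub>R f x \<partial>lebesgue_on \<Omega>) = - (\<integral>x. \<psi> x *\<^sub>R g x \<partial>lebesgue_on \<Omega>)"
    using zero K(3) by (simp add: restrict)
qed

section \<open>Absolute value, sign and even functions\<close>

lemma has_real_derivative_abs:
  fixes x :: real
  assumes "x \<noteq> 0"
  shows "(abs has_real_derivative sgn x) (at x)"
proof (cases "x > 0")
  case True
  show ?thesis
    by (rule has_field_derivative_transform_within_open[of "\<lambda>x. x" _ _ "{0<..}"])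
       (use True in auto)
next
  case False
  then have x: "x < 0" using assms by simp
  have "(uminus has_real_derivative - 1) (at x)"
    using DERIV_minus[OF DERIV_ident, of x UNIV] by simp
  then have "(abs has_real_derivative - 1) (at x)"
    by (rule has_field_derivative_transform_within_open[of _ _ _ "{..<0}"]) (use x in auto)
  then show ?thesis using x by simp
qed

lemma has_real_derivative_sgn:
  fixes x :: real
  assumes "x \<noteq> 0"
  shows "(sgn has_real_derivative 0) (at x)"
  by (rule has_field_derivative_transform_within_open[of "\<lambda>_. sgn x" _ _ "if x > 0 then {0<..} else {..<0}"])
     (use assms in \<open>auto split: if_splits\<close>)

lemma even_absolutely_integrable:
  fixes f :: "real \<Rightarrow> real"
  assumes even: "\<And>x. f (- x) = f x" and "f absolutely_integrable_on {0..}"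
  shows "f absolutely_integrable_on UNIV"
proof -
  have "f absolutely_integrable_on {..0}"
    using has_absolute_integral_reflect_real[of "{..0}" "{0..}" f "integral {0..} f"] assms
    by (auto simp: image_iff)
  then have "f absolutely_integrable_on {..0} \<union> {0..}"
    using assms(2) by (intro set_integrable_Un) auto
  moreover have "{..0} \<union> {0..} = (UNIV :: real set)" by auto
  ultimately show ?thesis by simp
qed

section \<open>The profile and its derivatives\<close>

locale rational_profile =
  fixes p lam1 lam2 Z :: real
  assumes p: "1 < p" "p < 5" and lam: "lam1 < 0" "lam2 < 0" and Z: "0 < Z"
begin

abbreviation "l \<equiv> l0 p lam1 lam2"
abbreviation "R \<equiv> R2 p lam1 lam2"
definition "d = R2_inv p lam1 lam2 (Z / 4)"
definition "k = - 2 * (p + 1) / ((p - 1)\<^sup>2 * lam1)"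
abbreviation "base \<equiv> profile_base p lam1 lam2 Z"
abbreviation "u \<equiv> profile p lam1 lam2 Z"
text \<open>The classical derivative of the profile off the origin. At the corner
  \<open>sgn 0 = 0\<close> gives the default value 0, so the bound of \<open>u'\<close> by a
  multiple of \<open>u\<close> holds at every point.\<close>

definition "u' x = - 2 * sgn x * R (\<bar>x\<bar> + d) * u x"
text \<open>The nonlinearity evaluated at the profile, with \<open>u x powr (p - 1)\<close> already
  rewritten as \<open>base x\<close>.\<close>

definition "v x = lam1 * u x * base x + lam2 * u x * (base x)\<^sup>2"

section \<open>The shift and the normal form of the base\<close>

lemma d: "- l < d" "R d = Z / 4"
proof -
  note bij = R2_bij_betw[OF p(1) lam]
  have "d \<in> {- l <..}"
    unfolding d_def R2_inv_def using bij Z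
    by (intro the_inv_into_into) (auto simp: bij_betw_def)
  then show "- l < d" by simp
  show "R d = Z / 4"
    unfolding d_def R2_inv_def using f_the_inv_into_f_bij_betw[OF bij] Z by simp
qed

lemma d_pos: "0 < d" using d(1) l0_neg[OF p(1) lam] by simp

lemma l_sq_less: "- l < y \<Longrightarrow> l\<^sup>2 < y\<^sup>2"
  using l0_neg[OF p(1) lam] power_strict_mono[of "- l" y 2] by simp

lemma shift_greater: "- l < \<bar>x\<bar> + d"
  using d(1) by linarith

text \<open>By the choice of \<open>l0\<close>, the constant term of the denominator is
  \<open>- l\<^sup>2\<close> times the coefficient of the square. That coefficient therefore factors
  out, and \<open>k\<close> is what remains of the numerator after cancelling it.\<close>

lemma base_eq: "base x = k / ((\<bar>x\<bar> + d)\<^sup>2 - l\<^sup>2)"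
proof -
  have "p * (p - 1)\<^sup>2 * lam1\<^sup>2 * l\<^sup>2 = - (p + 1)\<^sup>2 * lam2"
    using p lam by (simp add: l0_def power_mult_distrib power_divide)
  then have "p * (p - 1)\<^sup>2 * lam1\<^sup>2 * (\<bar>x\<bar> + d)\<^sup>2 + (p + 1)\<^sup>2 * lam2 =
      p * (p - 1)\<^sup>2 * lam1\<^sup>2 * ((\<bar>x\<bar> + d)\<^sup>2 - l\<^sup>2)"
    by (simp add: algebra_simps)
  moreover have "- 2 * p * (p + 1) * lam1 = p * (p - 1)\<^sup>2 * lam1\<^sup>2 * k"
  proof -
    have "p * (p - 1)\<^sup>2 * lam1\<^sup>2 * k = p * lam1 * (k * ((p - 1)\<^sup>2 * lam1))"
      by (simp only: power2_eq_square mult_ac)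
    also have "k * ((p - 1)\<^sup>2 * lam1) = - 2 * (p + 1)" using p lam by (simp add: k_def)
    finally show ?thesis by (simp only: mult_ac)
  qed
  moreover have "p * (p - 1)\<^sup>2 * lam1\<^sup>2 \<noteq> 0" using p lam by simp
  ultimately show ?thesis unfolding profile_base_def d_def[symmetric] by simp
qed

lemma base_pos: "0 < base x"
  using profile_base_pos[OF p(1) lam Z] .

lemma u_pos: "0 < u x"
  using base_pos[of x] by (simp add: profile_def)

lemma u_even: "u (- x) = u x"
  by (simp add: profile_def profile_base_def)

lemma k_pos: "0 < k"
  using p lam unfolding k_def by (intro divide_neg_neg) (auto simp: mult_pos_neg)

section \<open>Differentiation of the profile and the differential equation\<close>

lemma R_deriv:
  assumes "- l < y"
  shows "(R has_real_derivative - (y\<^sup>2 + l\<^sup>2) / ((p - 1) * (y\<^sup>2 - l\<^sup>2)\<^sup>2)) (at y)"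
proof -
  have nz: "y\<^sup>2 - l\<^sup>2 \<noteq> 0" "p - 1 \<noteq> 0" using l_sq_less[OF assms] p by auto
  have "((\<lambda>y. (p - 1) * (y\<^sup>2 - l\<^sup>2)) has_real_derivative (p - 1) * (2 * y)) (at y)"
    by (auto intro!: derivative_eq_intros)
  from DERIV_divide[OF DERIV_ident this] nz
  have "(R has_real_derivative
      (1 * ((p - 1) * (y\<^sup>2 - l\<^sup>2)) - y * ((p - 1) * (2 * y))) /
      (((p - 1) * (y\<^sup>2 - l\<^sup>2)) * ((p - 1) * (y\<^sup>2 - l\<^sup>2)))) (at y)"
    by (simp add: R2_def[abs_def])
  also have "1 * ((p - 1) * (y\<^sup>2 - l\<^sup>2)) - y * ((p - 1) * (2 * y)) = (p - 1) * - (y\<^sup>2 + l\<^sup>2)"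
    by (simp add: algebra_simps power2_eq_square)
  also have "(p - 1) * - (y\<^sup>2 + l\<^sup>2) / (((p - 1) * (y\<^sup>2 - l\<^sup>2)) * ((p - 1) * (y\<^sup>2 - l\<^sup>2))) =
      - (y\<^sup>2 + l\<^sup>2) / ((p - 1) * (y\<^sup>2 - l\<^sup>2)\<^sup>2)"
    unfolding mult.assoc mult_divide_mult_cancel_left[OF nz(2)] by (simp add: power2_eq_square mult_ac)
  finally show ?thesis .
qed

lemma abs_shift_deriv:
  assumes "x \<noteq> 0"
  shows "((\<lambda>x. \<bar>x\<bar> + d) has_real_derivative sgn x) (at x)"
  using DERIV_add[OF has_real_derivative_abs[OF assms] DERIV_const[of d]] by simp

text \<open>The logarithmic derivative of \<open>k / (y\<^sup>2 - l\<^sup>2)\<close> in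
  \<open>y\<close> is \<open>- 2 * y / (y\<^sup>2 - l\<^sup>2)\<close>, which is
  \<open>- 2 * (p - 1) * R y\<close>; the factor \<open>sgn x\<close> comes from the chain
  rule.\<close>

lemma base_deriv:
  assumes "x \<noteq> 0"
  shows "(base has_real_derivative - 2 * (p - 1) * sgn x * R (\<bar>x\<bar> + d) * base x) (at x)"
proof -
  define y where "y = \<bar>x\<bar> + d"
  have nz: "y\<^sup>2 - l\<^sup>2 \<noteq> 0" "p - 1 \<noteq> 0" using l_sq_less[OF shift_greater[of x]] p by (auto simp: y_def)
  have "((\<lambda>y. k / (y\<^sup>2 - l\<^sup>2)) has_real_derivative - (k * (2 * y)) / (y\<^sup>2 - l\<^sup>2)\<^sup>2) (at y)"
    using nz by (auto intro!: derivative_eq_intros simp: power2_eq_square)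
  from DERIV_chain2[OF this[unfolded y_def] abs_shift_deriv[OF assms]]
  have "(base has_real_derivative - (k * (2 * y)) / (y\<^sup>2 - l\<^sup>2)\<^sup>2 * sgn x) (at x)"
    by (simp only: base_eq[abs_def] y_def)
  also have "- (k * (2 * y)) / (y\<^sup>2 - l\<^sup>2)\<^sup>2 * sgn x = - 2 * sgn x * (y / (y\<^sup>2 - l\<^sup>2)) * (k / (y\<^sup>2 - l\<^sup>2))"
    by (simp add: power2_eq_square)
  also have "y / (y\<^sup>2 - l\<^sup>2) = (p - 1) * R y"
    using nz(2) by (simp add: R2_def)
  also have "- 2 * sgn x * ((p - 1) * R y) * (k / (y\<^sup>2 - l\<^sup>2)) =
      - 2 * (p - 1) * sgn x * R (\<bar>x\<bar> + d) * base x"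
    unfolding base_eq y_def by (simp only: mult_ac)
  finally show ?thesis .
qed

text \<open>The power \<open>1 / (p - 1)\<close> divides the logarithmic derivative by
  \<open>p - 1\<close> and so removes that factor from \<open>base_deriv\<close>.\<close>

lemma u_deriv:
  assumes "x \<noteq> 0"
  shows "(u has_real_derivative u' x) (at x)"
proof -
  have "((\<lambda>x. base x powr (1 / (p - 1))) has_real_derivative
      1 / (p - 1) * base x powr (1 / (p - 1) - of_nat 1) * (- 2 * (p - 1) * sgn x * R (\<bar>x\<bar> + d) * base x)) (at x)"
    by (rule DERIV_fun_powr[OF base_deriv[OF assms] base_pos])
  moreover have "base x powr (1 / (p - 1) - of_nat 1) = u x / base x"
    using base_pos[of x] by (simp add: profile_def powr_diff)
  moreover have "1 / (p - 1) * (u x / base x) * (- 2 * (p - 1) * sgn x * R (\<bar>x\<bar> + d) * base x) = u' x"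
  proof -
    have *: "1 / P * (a / b) * (- 2 * P * s * t * b) = - 2 * s * t * a"
      if "P \<noteq> 0" "b \<noteq> 0" for P a b s t :: real
      using that by simp
    show ?thesis unfolding u'_def by (rule *) (use p base_pos[of x] in auto)
  qed
  ultimately show ?thesis
    by (simp only: profile_def[abs_def])
qed

text \<open>Since \<open>sgn\<close> is locally constant and has square 1 off the origin, the
  product rule leaves \<open>4 * (R y)\<^sup>2 - 2 * q\<close> times \<open>u x\<close>, where
  \<open>q\<close> is the derivative of \<open>R\<close> at \<open>y\<close>. What remains is a
  rational identity in \<open>y\<close>.\<close>

lemma u'_deriv:
  assumes "x \<noteq> 0"
  shows "(u' has_real_derivative - v x) (at x)"
proof -
  define y where "y = \<bar>x\<bar> + d"
  define D where "D = y\<^sup>2 - l\<^sup>2"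
  define q where "q = - (y\<^sup>2 + l\<^sup>2) / ((p - 1) * D\<^sup>2)"
  have ly: "- l < y" using d by (simp add: y_def)
  have D: "D > 0" using l_sq_less[OF ly] by (simp add: D_def)
  have "((\<lambda>x. R (\<bar>x\<bar> + d)) has_real_derivative q * sgn x) (at x)"
    using DERIV_chain2[OF R_deriv[OF ly, unfolded y_def] abs_shift_deriv[OF assms]]
    by (simp add: q_def y_def D_def)
  from DERIV_mult[OF DERIV_mult[OF DERIV_cmult[OF has_real_derivative_sgn[OF assms], of "- 2"] this]
      u_deriv[OF assms]]
  have "(u' has_real_derivative
      (- 2 * 0 * R y + q * sgn x * (- 2 * sgn x)) * u x + u' x * (- 2 * sgn x * R y)) (at x)"
    by (simp only: u'_def[abs_def] y_def)
  also have "(- 2 * 0 * R y + q * sgn x * (- 2 * sgn x)) * u x + u' x * (- 2 * sgn x * R y) =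
      (4 * (R y)\<^sup>2 - 2 * q) * u x * (sgn x * sgn x)"
    by (simp add: u'_def y_def power2_eq_square algebra_simps)
  also have "sgn x * sgn x = 1" using assms by (simp add: sgn_if)
  finally have "(u' has_real_derivative (4 * (R y)\<^sup>2 - 2 * q) * u x) (at x)" by simp
  \<comment> \<open>Expansion in \<open>1 / D\<close> and \<open>1 / D\<^sup>2\<close>: the value of
    \<open>k\<close> matches the first coefficient to the \<open>lam1\<close> term, and the value of
    \<open>l0\<close> matches the second to the \<open>lam2\<close> term.\<close>
  moreover have "4 * (R y)\<^sup>2 - 2 * q = - (lam1 * base x + lam2 * (base x)\<^sup>2)"
  proof -
    have l: "lam2 * (p + 1)\<^sup>2 = - p * (p - 1)\<^sup>2 * lam1\<^sup>2 * l\<^sup>2"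
      using p lam by (simp add: l0_def power_mult_distrib power_divide)
    have "- (lam1 * k) = 2 * (p + 1) / (p - 1)\<^sup>2"
      using p lam by (simp add: k_def minus_divide_left)
    moreover have "- (lam2 * k\<^sup>2) = 4 * p * l\<^sup>2 / (p - 1)\<^sup>2"
    proof -
      have "lam2 * k\<^sup>2 = 4 * (lam2 * (p + 1)\<^sup>2) / ((p - 1) ^ 4 * lam1\<^sup>2)"
        by (simp add: k_def power_divide power_mult_distrib)
          (simp add: power2_eq_square algebra_simps)
      also have "\<dots> = - 4 * p * l\<^sup>2 / (p - 1)\<^sup>2"
      proof -
        have "4 * (- p * P\<^sup>2 * lam1\<^sup>2 * l\<^sup>2) / (P ^ 4 * lam1\<^sup>2) = - 4 * p * l\<^sup>2 / P\<^sup>2" if "P \<noteq> 0" for P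
          using that lam by (simp add: divide_simps power2_eq_square power4_eq_xxxx)
        then show ?thesis unfolding l using p by simp
      qed
      finally show ?thesis by simp
    qed
    moreover have "- (lam1 * base x + lam2 * (base x)\<^sup>2) = - (lam1 * k) / D + - (lam2 * k\<^sup>2) / D\<^sup>2"
      by (simp add: base_eq y_def D_def power_divide)
    ultimately have "- (lam1 * base x + lam2 * (base x)\<^sup>2) =
        2 * (p + 1) / (p - 1)\<^sup>2 / D + 4 * p * l\<^sup>2 / (p - 1)\<^sup>2 / D\<^sup>2" by simp
    also have "\<dots> = (2 * (p + 1) * D + 4 * p * l\<^sup>2) / ((p - 1)\<^sup>2 * D\<^sup>2)"
    proof -
      have "a / P\<^sup>2 / D + b / P\<^sup>2 / D\<^sup>2 = (a * D + b) / (P\<^sup>2 * D\<^sup>2)" if "P \<noteq> 0" for a b P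
        using that D by (simp add: divide_simps power2_eq_square)
      then show ?thesis using p by simp
    qed
    also have "2 * (p + 1) * D + 4 * p * l\<^sup>2 = 4 * y\<^sup>2 + 2 * (p - 1) * (y\<^sup>2 + l\<^sup>2)"
      by (simp add: D_def algebra_simps)
    also have "\<dots> / ((p - 1)\<^sup>2 * D\<^sup>2) = 4 * (R y)\<^sup>2 - 2 * q"
    proof -
      have "(4 * y\<^sup>2 + 2 * P * N) / (P\<^sup>2 * D\<^sup>2) = 4 * (y / (P * D))\<^sup>2 - 2 * (- N / (P * D\<^sup>2))"
        if "P \<noteq> 0" for P N
        using that D by (simp add: power_divide power_mult_distrib add_divide_distrib power2_eq_square)
      then show ?thesis using p by (simp only: R2_def q_def D_def[symmetric])
    qed
    finally show ?thesis by simp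
  qed
  moreover have "- (lam1 * base x + lam2 * (base x)\<^sup>2) * u x = - v x"
    by (simp add: v_def algebra_simps)
  ultimately show ?thesis by (simp only:)
qed

text \<open>Positivity of \<open>u\<close> removes the modulus, and multiplying the exponents by
  \<open>1 / (p - 1)\<close> turns them into 1 and 2.\<close>

lemma nonlinearity_u: "nonlinearity p lam1 lam2 (complex_of_real (u x)) = complex_of_real (v x)"
proof -
  have "u x powr (p - 1) = base x"
    using p base_pos[of x] by (simp add: profile_def powr_powr)
  moreover have "u x powr (2 * p - 2) = (base x)\<^sup>2"
  proof -
    have "1 / (p - 1) * (2 * p - 2) = 2" using p by (simp add: field_simps)
    then show ?thesis using base_pos[of x] by (simp only: profile_def powr_powr) simp
  qed
  ultimately show ?thesis
    using u_pos[of x] by (simp add: nonlinearity_def v_def)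
qed

section \<open>Continuity and the one-sided slopes at the origin\<close>

lemma continuous_on_R: "continuous_on A (\<lambda>x. R (\<bar>x\<bar> + d))"
proof -
  have "isCont (\<lambda>x. R (\<bar>x\<bar> + d)) x" for x
    using DERIV_isCont[OF R_deriv, of "\<bar>x\<bar> + d"] d(1)
    by (intro isCont_o2[of x "\<lambda>x. \<bar>x\<bar> + d" R]) (auto intro: continuous_intros)
  then show ?thesis by (simp add: continuous_at_imp_continuous_on)
qed

lemma continuous_on_base: "continuous_on A base"
  unfolding base_eq[abs_def] using l_sq_less d(1)
  by (intro continuous_intros) (smt (verit) abs_ge_zero)

lemma continuous_on_u: "continuous_on A u"
  unfolding profile_def[abs_def] using base_pos
  by (intro continuous_intros continuous_on_base) (auto simp: less_imp_neq[symmetric])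

lemma continuous_on_u': "continuous_on (- {0}) u'"
  using DERIV_isCont[OF u'_deriv] by (intro continuous_at_imp_continuous_on) auto

text \<open>This product is continuous through the origin, so the jump of \<open>u'\<close> comes
  from its sign factor alone. Leaving \<open>A\<close> free serves both one-sided limits.\<close>

lemma Ru_tendsto: "((\<lambda>x. R (\<bar>x\<bar> + d) * u x) \<longlongrightarrow> Z / 4 * u 0) (at 0 within A)"
proof -
  have "isCont (\<lambda>x. R (\<bar>x\<bar> + d) * u x) 0"
    using continuous_on_mult[OF continuous_on_R continuous_on_u, of UNIV]
    by (simp add: continuous_on_eq_continuous_at)
  then have "((\<lambda>x. R (\<bar>x\<bar> + d) * u x) \<longlongrightarrow> R d * u 0) (at 0)"
    by (simp add: isCont_def)
  then show ?thesis unfolding d(2) by (rule tendsto_within_subset) simp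
qed

lemma u'_at_right: "(u' \<longlongrightarrow> - (Z / 2) * u 0) (at_right 0)"
proof -
  have "((\<lambda>x. - 2 * (R (\<bar>x\<bar> + d) * u x)) \<longlongrightarrow> - 2 * (Z / 4 * u 0)) (at_right 0)"
    by (intro tendsto_mult_left Ru_tendsto)
  then have "(u' \<longlongrightarrow> - 2 * (Z / 4 * u 0)) (at_right 0)"
    by (rule Lim_transform_eventually) (auto simp: u'_def eventually_at_filter)
  then show ?thesis by simp
qed

lemma u'_at_left: "(u' \<longlongrightarrow> Z / 2 * u 0) (at_left 0)"
proof -
  have "((\<lambda>x. 2 * (R (\<bar>x\<bar> + d) * u x)) \<longlongrightarrow> 2 * (Z / 4 * u 0)) (at_left 0)"
    by (intro tendsto_mult_left Ru_tendsto)
  then have "(u' \<longlongrightarrow> 2 * (Z / 4 * u 0)) (at_left 0)"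
    by (rule Lim_transform_eventually) (auto simp: u'_def eventually_at_filter)
  then show ?thesis by simp
qed

section \<open>Pointwise bounds, decay and square integrability\<close>

lemma R_bounds: "0 \<le> R (\<bar>x\<bar> + d)" "R (\<bar>x\<bar> + d) \<le> Z / 4"
proof -
  show "0 \<le> R (\<bar>x\<bar> + d)"
    using l_sq_less[OF shift_greater[of x]] d_pos p by (simp add: R2_def)
  \<comment> \<open>The argument is at least \<open>d\<close>, where the decreasing \<open>R\<close>
    equals \<open>Z / 4\<close>; strict monotonicity leaves \<open>x = 0\<close> as a separate
    case.\<close>
  show "R (\<bar>x\<bar> + d) \<le> Z / 4"
    using R2_strictly_decreasing[OF p(1) lam d(1), of "\<bar>x\<bar> + d"] d(2) by (cases "x = 0") auto
qed

lemma abs_u'_le: "\<bar>u' x\<bar> \<le> Z / 2 * \<bar>u x\<bar>"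
proof -
  have "\<bar>u' x\<bar> = 2 * \<bar>sgn x\<bar> * R (\<bar>x\<bar> + d) * u x"
    using R_bounds(1)[of x] u_pos[of x] by (simp add: u'_def abs_mult)
  also have "\<dots> \<le> 2 * 1 * (Z / 4) * u x"
    using R_bounds[of x] u_pos[of x] by (intro mult_mono) (auto simp: sgn_if)
  finally show ?thesis using u_pos[of x] by simp
qed

lemma base_le: "base x \<le> base 0"
proof -
  have "0 < d\<^sup>2 - l\<^sup>2" "d\<^sup>2 \<le> (\<bar>x\<bar> + d)\<^sup>2"
    using l_sq_less[OF d(1)] d_pos by (auto intro!: power_mono)
  then show ?thesis unfolding base_eq using k_pos by (intro divide_left_mono) auto
qed

lemma abs_v_le: "\<bar>v x\<bar> \<le> (\<bar>lam1\<bar> * base 0 + \<bar>lam2\<bar> * (base 0)\<^sup>2) * \<bar>u x\<bar>"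
proof -
  have "\<bar>v x\<bar> = \<bar>lam1 * base x + lam2 * (base x)\<^sup>2\<bar> * \<bar>u x\<bar>"
    unfolding abs_mult[symmetric] by (simp add: v_def algebra_simps)
  also have "\<dots> \<le> (\<bar>lam1\<bar> * base 0 + \<bar>lam2\<bar> * (base 0)\<^sup>2) * \<bar>u x\<bar>"
  proof (intro mult_right_mono order.trans[OF abs_triangle_ineq] add_mono)
    show "\<bar>lam1 * base x\<bar> \<le> \<bar>lam1\<bar> * base 0"
      using base_le[of x] base_pos[of x] by (simp add: abs_mult mult_left_mono)
    show "\<bar>lam2 * (base x)\<^sup>2\<bar> \<le> \<bar>lam2\<bar> * (base 0)\<^sup>2"
      using base_le[of x] base_pos[of x] by (simp add: abs_mult mult_left_mono power_mono)
  qed simp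
  finally show ?thesis .
qed

text \<open>The denominator \<open>1 - l\<^sup>2 / d\<^sup>2\<close> is the minimum of
  \<open>(y\<^sup>2 - l\<^sup>2) / y\<^sup>2\<close> over \<open>y \<ge> d\<close>, which makes
  \<open>c\<close> a constant for inverse-square decay of the base.\<close>

definition "c = k / (1 - l\<^sup>2 / d\<^sup>2)"

lemma base_decay:
  assumes "0 < x"
  shows "base x \<le> c * x powr (- 2)"
proof -
  define r where "r = 1 - l\<^sup>2 / d\<^sup>2"
  have r: "0 < r" using l_sq_less[OF d(1)] d_pos by (simp add: r_def)
  have "d\<^sup>2 \<le> (\<bar>x\<bar> + d)\<^sup>2" using d_pos by (intro power_mono) auto
  then have "l\<^sup>2 / d\<^sup>2 * d\<^sup>2 \<le> l\<^sup>2 / d\<^sup>2 * (\<bar>x\<bar> + d)\<^sup>2" by (intro mult_left_mono) auto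
  then have "r * (\<bar>x\<bar> + d)\<^sup>2 \<le> (\<bar>x\<bar> + d)\<^sup>2 - l\<^sup>2" using d_pos by (simp add: r_def algebra_simps)
  moreover have "r * x\<^sup>2 \<le> r * (\<bar>x\<bar> + d)\<^sup>2"
    using r d_pos assms by (intro mult_left_mono power_mono) auto
  ultimately have "r * x\<^sup>2 \<le> (\<bar>x\<bar> + d)\<^sup>2 - l\<^sup>2" by simp
  then have "base x \<le> k / (r * x\<^sup>2)"
    unfolding base_eq using r k_pos assms l_sq_less[OF shift_greater[of x]]
    by (intro divide_left_mono) (auto intro!: mult_pos_pos)
  also have "\<dots> = c * x powr (- 2)"
    using assms by (simp add: c_def r_def powr_minus_divide)
  finally show ?thesis .
qed

lemma u_square_integrable: "(\<lambda>x. (u x)\<^sup>2) absolutely_integrable_on UNIV"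
proof (rule even_absolutely_integrable)
  show "(u (- x))\<^sup>2 = (u x)\<^sup>2" for x by (simp add: u_even)
  define e where "e = - (4 / (p - 1))"
  \<comment> \<open>The decisive use of \<open>p < 5\<close>: it places the exponent in the range
    where the power is integrable at infinity.\<close>
  have e: "e < - 1" using p by (simp add: e_def field_simps)
  have cont: "continuous_on A (\<lambda>x. (u x)\<^sup>2)" for A
    by (intro continuous_intros continuous_on_u)
  \<comment> \<open>The comparison power is not integrable at 0, hence the split at 1; on the
    bounded piece continuity suffices.\<close>
  have "(\<lambda>x. (u x)\<^sup>2) absolutely_integrable_on {0..1}"
    by (intro absolutely_integrable_continuous_real cont)
  moreover have "(\<lambda>x. (u x)\<^sup>2) absolutely_integrable_on {1..}"
  proof (rule measurable_bounded_by_integrable_imp_absolutely_integrable)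
    show "(\<lambda>x. (u x)\<^sup>2) \<in> borel_measurable (lebesgue_on {1..})"
      by (intro continuous_imp_measurable_on_sets_lebesgue cont) auto
    show "(\<lambda>x. c powr (2 / (p - 1)) * x powr e) integrable_on {1..}"
      by (rule has_integral_integrable[OF has_integral_mult_right[OF has_integral_powr_to_inf[OF e zero_less_one]]])
    show "norm ((u x)\<^sup>2) \<le> c powr (2 / (p - 1)) * x powr e" if "x \<in> {1..}" for x
    proof -
      have x: "0 < x" using that by simp
      have "(u x)\<^sup>2 = base x powr (2 / (p - 1))"
        using base_pos[of x] by (simp add: profile_def power2_eq_square powr_add[symmetric])
      also have "\<dots> \<le> (c * x powr (- 2)) powr (2 / (p - 1))"
        using base_decay[OF x] base_pos[of x] p by (intro powr_mono2) auto
      also have "\<dots> = c powr (2 / (p - 1)) * x powr e"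
        by (simp add: powr_mult powr_powr e_def)
      finally show ?thesis by simp
    qed
  qed simp
  ultimately have "(\<lambda>x. (u x)\<^sup>2) absolutely_integrable_on {0..1} \<union> {1..}"
    by (intro set_integrable_Un) auto
  moreover have "{0..1} \<union> {1..} = {0::real..}" by auto
  ultimately show "(\<lambda>x. (u x)\<^sup>2) absolutely_integrable_on {0..}" by simp
qed

lemma u_L2: "(\<lambda>x. complex_of_real (u x)) \<in> L2 UNIV"
proof -
  have "u \<in> borel_measurable borel"
    using continuous_on_u by (rule borel_measurable_continuous_onI)
  then have "(\<lambda>x. complex_of_real (u x)) \<in> borel_measurable lebesgue"
    by (intro measurable_completion) simp
  then show ?thesis
    using u_square_integrable by (simp add: L2_def lebesgue_on_UNIV_eq set_integrable_def)
qed

lemma L2_of_real_dominated: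
  assumes "f \<in> borel_measurable borel" "\<And>x. \<bar>f x\<bar> \<le> C * \<bar>u x\<bar>"
  shows "(\<lambda>x. complex_of_real (f x)) \<in> L2 UNIV"
proof (rule L2_dominated[OF u_L2])
  show "(\<lambda>x. complex_of_real (f x)) \<in> borel_measurable (lebesgue_on UNIV)"
    unfolding lebesgue_on_UNIV_eq using assms(1) by (intro measurable_completion) simp
qed (use assms(2) in simp)

lemma u'_L2: "(\<lambda>x. complex_of_real (u' x)) \<in> L2 UNIV"
proof (rule L2_of_real_dominated[OF _ abs_u'_le])
  \<comment> \<open>As \<open>u'\<close> jumps at the origin, its measurability is obtained from its
    factors and not from continuity.\<close>
  have [measurable]: "u \<in> borel_measurable borel" "(\<lambda>x. R (\<bar>x\<bar> + d)) \<in> borel_measurable borel"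
    using continuous_on_u continuous_on_R by (auto intro: borel_measurable_continuous_onI)
  show "u' \<in> borel_measurable borel"
    unfolding u'_def[abs_def] by measurable
qed

lemma v_L2: "(\<lambda>x. complex_of_real (v x)) \<in> L2 UNIV"
proof (rule L2_of_real_dominated[OF _ abs_v_le])
  have "continuous_on UNIV v"
    unfolding v_def[abs_def] by (intro continuous_intros continuous_on_u continuous_on_base)
  then show "v \<in> borel_measurable borel" by (rule borel_measurable_continuous_onI)
qed

section \<open>Weak derivatives, operator domain and the two forms of the equation\<close>

lemma u_has_weak_deriv:
  assumes "open \<Omega>"
  shows "has_weak_deriv \<Omega> (\<lambda>x. complex_of_real (u x)) (\<lambda>x. complex_of_real (u' x))"
\<comment> \<open>The open set may contain the origin, as it does for membership in
  \<open>H1 UNIV\<close>; the corner is harmless because \<open>u\<close> is continuous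
  there.\<close>
proof (rule has_weak_derivI[of _ _ "{0}"])
  show "((\<lambda>x. complex_of_real (u x)) has_vector_derivative complex_of_real (u' x)) (at x)"
    if "x \<in> \<Omega> - {0}" for x
    using that by (auto intro!: has_vector_derivative_of_real u_deriv)
qed (use assms in \<open>auto intro!: continuous_intros continuous_on_u L2_imp_locally_integrable
       L2_UNIV_subset[OF u_L2] L2_UNIV_subset[OF u'_L2]\<close>)

text \<open>This is confined to the complement of the origin: across it the jump of
  \<open>u'\<close> would add a Dirac mass to the weak derivative.\<close>

lemma u'_has_weak_deriv:
  "has_weak_deriv (- {0}) (\<lambda>x. complex_of_real (u' x)) (\<lambda>x. - complex_of_real (v x))"
proof (rule has_weak_derivI[of _ _ "{}"])
  show "((\<lambda>x. complex_of_real (u' x)) has_vector_derivative - complex_of_real (v x)) (at x)"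
    if "x \<in> - {0} - {}" for x
    using that has_vector_derivative_of_real[OF u'_deriv[of x]] by simp
  have "(\<lambda>x. complex_of_real (- v x)) \<in> L2 UNIV"
    using v_L2 by (simp add: L2_def)
  then show "locally_integrable (- {0}) (\<lambda>x. - complex_of_real (v x))"
    by (auto intro!: L2_imp_locally_integrable L2_UNIV_subset)
qed (auto intro!: continuous_intros continuous_on_u' L2_imp_locally_integrable L2_UNIV_subset[OF u'_L2])

lemma u'_limits:
  "((\<lambda>x. complex_of_real (u' x)) \<longlongrightarrow> complex_of_real (- (Z / 2) * u 0)) (at_right 0)"
  "((\<lambda>x. complex_of_real (u' x)) \<longlongrightarrow> complex_of_real (Z / 2 * u 0)) (at_left 0)"
  by (intro tendsto_of_real u'_at_right u'_at_left)+

lemma jump: "complex_of_real (- (Z / 2) * u 0) - complex_of_real (Z / 2 * u 0) =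
    - complex_of_real Z * complex_of_real (u 0)"
  by (simp add: field_simps)

lemma u_delta_domain: "(\<lambda>x. complex_of_real (u x)) \<in> delta_domain Z"
proof -
  have "(\<lambda>x. - complex_of_real (v x)) \<in> L2 UNIV"
    using v_L2 by (simp add: L2_def)
  then have "(\<lambda>x. complex_of_real (u' x)) \<in> H1 (- {0})"
    unfolding H1_def using u'_has_weak_deriv u'_L2
    by (auto intro!: L2_UNIV_subset bexI[of _ "\<lambda>x. - complex_of_real (v x)"])
  then have "(\<lambda>x. complex_of_real (u x)) \<in> H2 (- {0})"
    unfolding H2_def using u_has_weak_deriv[of "- {0}"] u_L2 by (auto intro: L2_UNIV_subset)
  moreover have "(\<lambda>x. complex_of_real (u x)) \<in> H1 UNIV"
    unfolding H1_def using u_has_weak_deriv[of UNIV] u_L2 u'_L2 by auto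
  moreover have "delta_jump_condition Z (\<lambda>x. complex_of_real (u x))"
    unfolding delta_jump_condition_def
  \<comment> \<open>The profile is its own continuous representative, and \<open>u'\<close> is the
    representative of its weak derivative that is continuous off the origin.\<close>
  proof (intro exI conjI)
    show "continuous_on UNIV (\<lambda>x. complex_of_real (u x))"
      by (intro continuous_intros continuous_on_u)
    show "continuous_on (- {0}) (\<lambda>x. complex_of_real (u' x))"
      by (intro continuous_intros continuous_on_u')
  qed (use u_has_weak_deriv[of "- {0}"] u'_limits jump in auto)
  ultimately show ?thesis by (simp add: delta_domain_def)
qed

lemma u_equilibrium: "equilibrium p lam1 lam2 Z (\<lambda>x. complex_of_real (u x))"
proof -
  \<comment> \<open>The witness is \<open>v\<close>, which agrees with the nonlinearity at every
    point and not only almost everywhere.\<close>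
  have "delta_op Z (\<lambda>x. complex_of_real (u x)) (\<lambda>x. complex_of_real (v x))"
    unfolding delta_op_def
    using u_delta_domain v_L2 u_has_weak_deriv[of "- {0}"] u'_has_weak_deriv by auto
  then show ?thesis
    unfolding equilibrium_def using u_delta_domain nonlinearity_u by auto
qed

lemma u_classical_equilibrium:
  "classical_equilibrium p lam1 lam2 Z (\<lambda>x. complex_of_real (u x))"
  unfolding classical_equilibrium_def
proof (intro exI conjI allI impI)
  show "continuous_on UNIV (\<lambda>x. complex_of_real (u x))"
    by (intro continuous_intros continuous_on_u)
  fix x :: real assume "x \<noteq> 0"
  then show "((\<lambda>x. complex_of_real (u x)) has_vector_derivative complex_of_real (u' x)) (at x)"
    "((\<lambda>x. complex_of_real (u' x)) has_vector_derivative complex_of_real (- v x)) (at x)"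
    by (intro has_vector_derivative_of_real u_deriv u'_deriv; assumption)+
  show "complex_of_real (- v x) + nonlinearity p lam1 lam2 (complex_of_real (u x)) = 0"
    by (simp add: nonlinearity_u)
qed (fact u'_limits jump)+

end

theorem theorem3p7:
  fixes p lam1 lam2 Z :: real
  assumes "1 < p" and "p < 5"
    and "lam1 < 0" and "lam2 < 0" and "Z > 0"
  shows "(\<forall>x. profile p lam1 lam2 Z x > 0) \<and>
         (\<forall>x. profile p lam1 lam2 Z (- x) = profile p lam1 lam2 Z x) \<and>
         equilibrium p lam1 lam2 Z (\<lambda>x. complex_of_real (profile p lam1 lam2 Z x)) \<and>
         classical_equilibrium p lam1 lam2 Z (\<lambda>x. complex_of_real (profile p lam1 lam2 Z x))"
proof -
  interpret rational_profile p lam1 lam2 Z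
    using assms by unfold_locales
  show ?thesis
    using u_pos u_even u_equilibrium u_classical_equilibrium by blast
qed

end
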